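(* Let $\pi$ be a commutative semigroup and let $(\{A_\varphi\}_{\varphi\in\pi},\{\ast_{p,q}\}_{p,q\in\pi})$ be a pre-Lie T-algebra. Define $$[a,b]_{p,q}:=a\ast_{p,q}b-b\ast_{q,p}a$$ for $a\in A_p$, $b\in A_q$ and $p,q\in\pi$. Then $(\{A_\varphi\}_{\varphi\in\pi},\{[,]_{p,q}\}_{p,q\in\pi})$ is a Lie T-algebra.
   Context: $K$ is a field; all vector spaces, tensor products and linear maps are over $K$. For a commutative semigroup $\pi$, a pre-Lie T-algebra is a family of vector spaces $\{A_\varphi\}_{\varphi\in\pi}$ with bilinear operations $\ast_{p,q}:A_p\otimes A_q\to A_{pq}$ such that $a\ast_{p,qt}(b\ast_{q,t}c)-(a\ast_{p,q}b)\ast_{pq,t}c=b\ast_{q,pt}(a\ast_{p,t}c)-(b\ast_{q,p}a)\ast_{qp,t}c$ for all $p,q,t\in\pi$, $a\in A_p,b\in A_q,c\in A_t$. A Lie T-algebra is a family of vector spaces $\{A_\varphi\}_{\varphi\in\pi}$ with bilinear operations $[,]_{p,q}:A_p\otimes A_q\to A_{pq}$ such that $[a,b]_{p,q}+[b,a]_{q,p}=0$ and $[[a,b]_{p,q},c]_{pq,t}+[[b,c]_{q,t},a]_{qt,p}+[[c,a]_{t,p},b]_{tp,q}=0$ for all $p,q,t\in\pi$, $a\in A_p,b\in A_q,c\in A_t$. *)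

theory Defs
  imports "HOL-Algebra.Module"
begin

text \<open>
  A vector space over \<open>K\<close> is a HOL-Algebra module over \<open>K\<close>, where \<open>K\<close> is a field. Each \<open>A p\<close> is a
  module record of its own: the carriers live in a common type, but they may overlap arbitrarily,
  and the zero, addition and scalar multiplication of \<open>A p\<close> are unrelated to those of \<open>A q\<close>.
  Operations are only constrained on the carriers. The multiplication and unit fields that module
  records inherit from ring records are never used.
\<close>

locale vector_space_family = field K for K :: "('k, 'm) ring_scheme" (structure) +
  fixes A :: "'p \<Rightarrow> ('k, 'a, 'n) module_scheme"
  assumes vector_space: "module K (A p)"

definition bilinear_map ::
  "('k, 'm) ring_scheme \<Rightarrow> ('k, 'a, 'n) module_scheme \<Rightarrow> ('k, 'a, 'n) module_scheme
    \<Rightarrow> ('k, 'a, 'n) module_scheme \<Rightarrow> ('a \<Rightarrow> 'a \<Rightarrow> 'a) \<Rightarrow> bool"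
  where
  "bilinear_map K U V W f \<longleftrightarrow>
    (\<forall>u \<in> carrier U. \<forall>v \<in> carrier V. f u v \<in> carrier W) \<and>
    (\<forall>u \<in> carrier U. \<forall>u' \<in> carrier U. \<forall>v \<in> carrier V.
      f (u \<oplus>\<^bsub>U\<^esub> u') v = f u v \<oplus>\<^bsub>W\<^esub> f u' v) \<and>
    (\<forall>u \<in> carrier U. \<forall>v \<in> carrier V. \<forall>v' \<in> carrier V.
      f u (v \<oplus>\<^bsub>V\<^esub> v') = f u v \<oplus>\<^bsub>W\<^esub> f u v') \<and>
    (\<forall>k \<in> carrier K. \<forall>u \<in> carrier U. \<forall>v \<in> carrier V.
      f (k \<odot>\<^bsub>U\<^esub> u) v = k \<odot>\<^bsub>W\<^esub> f u v) \<and>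
    (\<forall>k \<in> carrier K. \<forall>u \<in> carrier U. \<forall>v \<in> carrier V.
      f u (k \<odot>\<^bsub>V\<^esub> v) = k \<odot>\<^bsub>W\<^esub> f u v)"

locale pre_lie_T_algebra = vector_space_family K A
  for K :: "('k, 'm) ring_scheme" (structure)
    and A :: "'p::ab_semigroup_mult \<Rightarrow> ('k, 'a, 'n) module_scheme" +
  fixes star :: "'p \<Rightarrow> 'p \<Rightarrow> 'a \<Rightarrow> 'a \<Rightarrow> 'a"
  assumes star_bilinear: "bilinear_map K (A p) (A q) (A (p * q)) (star p q)"
    and pre_lie: "\<lbrakk>a \<in> carrier (A p); b \<in> carrier (A q); c \<in> carrier (A t)\<rbrakk> \<Longrightarrow>
      star p (q * t) a (star q t b c) \<ominus>\<^bsub>A (p * q * t)\<^esub> star (p * q) t (star p q a b) c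
      = star q (p * t) b (star p t a c) \<ominus>\<^bsub>A (p * q * t)\<^esub> star (q * p) t (star q p b a) c"

locale lie_T_algebra = vector_space_family K A
  for K :: "('k, 'm) ring_scheme" (structure)
    and A :: "'p::ab_semigroup_mult \<Rightarrow> ('k, 'a, 'n) module_scheme" +
  fixes bracket :: "'p \<Rightarrow> 'p \<Rightarrow> 'a \<Rightarrow> 'a \<Rightarrow> 'a"
  assumes bracket_bilinear: "bilinear_map K (A p) (A q) (A (p * q)) (bracket p q)"
    and antisymmetry: "\<lbrakk>a \<in> carrier (A p); b \<in> carrier (A q)\<rbrakk> \<Longrightarrow>
      bracket p q a b \<oplus>\<^bsub>A (p * q)\<^esub> bracket q p b a = \<zero>\<^bsub>A (p * q)\<^esub>"
    and jacobi: "\<lbrakk>a \<in> carrier (A p); b \<in> carrier (A q); c \<in> carrier (A t)\<rbrakk> \<Longrightarrow>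
      bracket (p * q) t (bracket p q a b) c
        \<oplus>\<^bsub>A (p * q * t)\<^esub> bracket (q * t) p (bracket q t b c) a
        \<oplus>\<^bsub>A (p * q * t)\<^esub> bracket (t * p) q (bracket t p c a) b
      = \<zero>\<^bsub>A (p * q * t)\<^esub>"

end

theory Submission imports Defs begin

text \<open>
  Bilinearity expands the cyclic sum of the double commutators into twelve terms of \<open>A (p * q * t)\<close>.
  They group into the pre-Lie identity for \<open>(a, b, c)\<close>, \<open>(b, c, a)\<close> and \<open>(c, a, b)\<close>, each of which
  contributes zero.
\<close>

lemma (in abelian_group) eq_minusI:
  assumes "x \<in> carrier G" "y \<in> carrier G" "z \<in> carrier G" "z = x \<oplus> y"
  shows "x = z \<ominus> y"
  using assms by (simp add: minus_eq a_assoc r_neg)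

text \<open>The sum regroups as \<open>(z \<ominus> w) \<ominus> (x \<ominus> y)\<close>. With
  \<open>x\<close>, \<open>z\<close> right-nested and \<open>y\<close>, \<open>w\<close> left-nested
  products, this turns the pre-Lie identity into a vanishing sum whose signs are those of the Jacobi
  sum.\<close>

lemma (in abelian_group) minus_eq_minus_imp_sum_zero:
  assumes "x \<in> carrier G" "y \<in> carrier G" "z \<in> carrier G" "w \<in> carrier G"
    and "x \<ominus> y = z \<ominus> w"
  shows "(y \<ominus> w) \<oplus> (z \<ominus> x) = \<zero>"
proof -
  have "(y \<ominus> w) \<oplus> (z \<ominus> x) = (z \<ominus> w) \<oplus> \<ominus> (x \<ominus> y)"
    using assms(1-4) by (simp add: minus_eq minus_add a_ac)
  also have "\<dots> = \<zero>"
    using assms by (simp add: r_neg)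
  finally show ?thesis .
qed

lemma bilinear_mapD:
  assumes "bilinear_map K U V W f" "u \<in> carrier U" "v \<in> carrier V"
  shows "f u v \<in> carrier W"
    and "u' \<in> carrier U \<Longrightarrow> f (u \<oplus>\<^bsub>U\<^esub> u') v = f u v \<oplus>\<^bsub>W\<^esub> f u' v"
    and "v' \<in> carrier V \<Longrightarrow> f u (v \<oplus>\<^bsub>V\<^esub> v') = f u v \<oplus>\<^bsub>W\<^esub> f u v'"
    and "k \<in> carrier K \<Longrightarrow> f (k \<odot>\<^bsub>U\<^esub> u) v = k \<odot>\<^bsub>W\<^esub> f u v"
    and "k \<in> carrier K \<Longrightarrow> f u (k \<odot>\<^bsub>V\<^esub> v) = k \<odot>\<^bsub>W\<^esub> f u v"
  using assms unfolding bilinear_map_def by blast+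

lemma bilinear_map_flip:
  "bilinear_map K U V W f \<Longrightarrow> bilinear_map K V U W (\<lambda>v u. f u v)"
  unfolding bilinear_map_def by blast

text \<open>Additivity alone suffices: apply \<open>f\<close> to \<open>u = (u - u') + u'\<close>
  and solve for the first summand.\<close>

lemma bilinear_map_minus_left:
  assumes f: "bilinear_map K U V W f" and "abelian_group U" "abelian_group W"
    and u: "u \<in> carrier U" "u' \<in> carrier U" and v: "v \<in> carrier V"
  shows "f (u \<ominus>\<^bsub>U\<^esub> u') v = f u v \<ominus>\<^bsub>W\<^esub> f u' v"
proof -
  interpret U: abelian_group U by fact
  interpret W: abelian_group W by fact
  have "u = (u \<ominus>\<^bsub>U\<^esub> u') \<oplus>\<^bsub>U\<^esub> u'"
    using u by (simp add: U.minus_eq U.a_assoc U.l_neg)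
  then have "f u v = f (u \<ominus>\<^bsub>U\<^esub> u') v \<oplus>\<^bsub>W\<^esub> f u' v"
    using bilinear_mapD(2)[OF f _ v u(2), of "u \<ominus>\<^bsub>U\<^esub> u'"] u by simp
  then show ?thesis
    using W.eq_minusI bilinear_mapD(1)[OF f _ v] u by simp
qed

lemma bilinear_map_minus_right:
  assumes "bilinear_map K U V W f" "abelian_group V" "abelian_group W"
    and "u \<in> carrier U" "v \<in> carrier V" "v' \<in> carrier V"
  shows "f u (v \<ominus>\<^bsub>V\<^esub> v') = f u v \<ominus>\<^bsub>W\<^esub> f u v'"
  using bilinear_map_minus_left[OF bilinear_map_flip[OF assms(1)]] assms by blast

lemma bilinear_map_diff:
  assumes f: "bilinear_map K U V W f" and g: "bilinear_map K U V W g"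
    and "module K U" "module K V" "module K W"
  shows "bilinear_map K U V W (\<lambda>u v. f u v \<ominus>\<^bsub>W\<^esub> g u v)"
proof -
  interpret U: module K U by fact
  interpret V: module K V by fact
  interpret W: module K W by fact
  note closed = bilinear_mapD(1)[OF f] bilinear_mapD(1)[OF g]
  note lin = bilinear_mapD(2-)[OF f] bilinear_mapD(2-)[OF g]
  show ?thesis
    unfolding bilinear_map_def
    by (intro conjI ballI)
      (simp_all add: closed lin W.minus_eq W.minus_add W.a_ac W.smult_r_distr W.smult_r_minus)
qed

context pre_lie_T_algebra
begin

abbreviation commutator :: "'p \<Rightarrow> 'p \<Rightarrow> 'a \<Rightarrow> 'a \<Rightarrow> 'a"
  where "commutator p q a b \<equiv> star p q a b \<ominus>\<^bsub>A (p * q)\<^esub> star q p b a"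

lemma abelian_group_A: "abelian_group (A p)"
  using vector_space[of p] by (rule module.axioms(2))

text \<open>The target index is a free \<open>r\<close> with \<open>p * q = r\<close>, so that
  membership can be obtained at any rearrangement of a product of indices.\<close>

lemma star_closed:
  "\<lbrakk>a \<in> carrier (A p); b \<in> carrier (A q); p * q = r\<rbrakk> \<Longrightarrow> star p q a b \<in> carrier (A r)"
  using bilinear_mapD(1)[OF star_bilinear] by blast

lemma commutator_bilinear: "bilinear_map K (A p) (A q) (A (p * q)) (commutator p q)"
proof -
  have "bilinear_map K (A p) (A q) (A (p * q)) (\<lambda>a b. star q p b a)"
    \<comment> \<open>The flipped product takes values in \<open>A (q * p)\<close>; commutativity of
      the index semigroup makes this the same space as \<open>A (p * q)\<close>.\<close>
    using bilinear_map_flip[OF star_bilinear[of q p]] by (simp add: mult.commute)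
  then show ?thesis
    by (intro bilinear_map_diff star_bilinear vector_space)
qed

lemma commutator_antisymmetric:
  assumes "a \<in> carrier (A p)" "b \<in> carrier (A q)"
  shows "commutator p q a b \<oplus>\<^bsub>A (p * q)\<^esub> commutator q p b a = \<zero>\<^bsub>A (p * q)\<^esub>"
proof -
  interpret W: abelian_group "A (p * q)" by (rule abelian_group_A)
  have "star p q a b \<in> carrier (A (p * q))" "star q p b a \<in> carrier (A (p * q))"
    using assms by (simp_all add: star_closed mult.commute)
  then show ?thesis
    \<comment> \<open>This is the degenerate instance \<open>x = y\<close>, \<open>z = w\<close>,
      where both differences in the premise are zero.\<close>
    unfolding mult.commute[of q p] by (intro W.minus_eq_minus_imp_sum_zero) (simp_all add: W.minus_eq W.r_neg)
qed

text \<open>The outer products are additive in each argument, so each one splits over the inner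
  difference. The free index \<open>r\<close> lets all three cyclic rotations live in one space. The
  labels \<open>q * p\<close> are left unnormalized so that the terms match those of the pre-Lie
  identity.\<close>

lemma commutator_commutator:
  assumes a: "a \<in> carrier (A p)" and b: "b \<in> carrier (A q)" and c: "c \<in> carrier (A t)"
    and r: "p * q * t = r"
  shows "commutator (p * q) t (commutator p q a b) c =
    (star (p * q) t (star p q a b) c \<ominus>\<^bsub>A r\<^esub> star (q * p) t (star q p b a) c)
      \<ominus>\<^bsub>A r\<^esub> (star t (p * q) c (star p q a b) \<ominus>\<^bsub>A r\<^esub> star t (q * p) c (star q p b a))"
proof -
  have "star p q a b \<in> carrier (A (p * q))" "star q p b a \<in> carrier (A (p * q))"
    using a b by (simp_all add: star_closed mult.commute)
  moreover have "bilinear_map K (A (p * q)) (A t) (A r) (star (p * q) t)"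
    "bilinear_map K (A t) (A (p * q)) (A r) (star t (p * q))"
    using star_bilinear[of "p * q" t] star_bilinear[of t "p * q"] r by (simp_all add: mult.commute)
  ultimately show ?thesis
    unfolding r mult.commute[of q p]
    using c by (simp add: bilinear_map_minus_left bilinear_map_minus_right abelian_group_A)
qed

text \<open>This is the pre-Lie identity rearranged: the difference of the left-nested products in
  \<open>a\<close> and \<open>b\<close> is cancelled by that of the right-nested ones.\<close>

lemma pre_lie_sum_zero:
  assumes "a \<in> carrier (A p)" "b \<in> carrier (A q)" "c \<in> carrier (A t)" and r: "p * q * t = r"
  shows "(star (p * q) t (star p q a b) c \<ominus>\<^bsub>A r\<^esub> star (q * p) t (star q p b a) c)
    \<oplus>\<^bsub>A r\<^esub> (star q (p * t) b (star p t a c) \<ominus>\<^bsub>A r\<^esub> star p (q * t) a (star q t b c)) = \<zero>\<^bsub>A r\<^esub>"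
proof -
  interpret W: abelian_group "A r" by (rule abelian_group_A)
  show ?thesis
    using pre_lie[OF assms(1-3)] assms(1-3) unfolding r
    by (intro W.minus_eq_minus_imp_sum_zero)
      (auto intro!: star_closed simp: r[symmetric] mult.assoc mult.commute mult.left_commute)
qed

lemma commutator_jacobi:
  assumes a: "a \<in> carrier (A p)" and b: "b \<in> carrier (A q)" and c: "c \<in> carrier (A t)"
  shows "commutator (p * q) t (commutator p q a b) c
      \<oplus>\<^bsub>A (p * q * t)\<^esub> commutator (q * t) p (commutator q t b c) a
      \<oplus>\<^bsub>A (p * q * t)\<^esub> commutator (t * p) q (commutator t p c a) b
    = \<zero>\<^bsub>A (p * q * t)\<^esub>"
proof -
  define r where "r = p * q * t"
  interpret W: abelian_group "A r" by (rule abelian_group_A)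
  have r: "p * q * t = r" "q * t * p = r" "t * p * q = r"
    by (simp_all add: r_def ac_simps)
  \<comment> \<open>\<open>R\<close> and \<open>L\<close> name the left-nested and right-nested
    triple products. With the nesting hidden, the Jacobi sum is a plain sum of twelve elements of
    \<open>A r\<close>, one \<open>R\<close> and one \<open>L\<close> for each ordering of the three
    arguments.\<close>
  define R where "R p q t a b c = star (p * q) t (star p q a b) c" for p q t a b c
  define L where "L p q t a b c = star p (q * t) a (star q t b c)" for p q t a b c
  have R_closed: "R x y z u v w \<in> carrier (A r)" and L_closed: "L x y z u v w \<in> carrier (A r)"
    if "u \<in> carrier (A x)" "v \<in> carrier (A y)" "w \<in> carrier (A z)" "x * y * z = r" for x y z u v w
    using that by (auto simp: R_def L_def mult.assoc intro!: star_closed)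
  have r': "q * p * t = r" "t * q * p = r" "p * t * q = r"
    by (simp_all add: r_def ac_simps)
  note closed = R_closed[OF a b c r(1)] R_closed[OF b c a r(2)] R_closed[OF c a b r(3)]
    R_closed[OF b a c r'(1)] R_closed[OF c b a r'(2)] R_closed[OF a c b r'(3)]
    L_closed[OF a b c r(1)] L_closed[OF b c a r(2)] L_closed[OF c a b r(3)]
    L_closed[OF b a c r'(1)] L_closed[OF c b a r'(2)] L_closed[OF a c b r'(3)]
  note comm = commutator_commutator[OF a b c r(1)] commutator_commutator[OF b c a r(2)]
    commutator_commutator[OF c a b r(3)]
  note zero = pre_lie_sum_zero[OF a b c r(1)] pre_lie_sum_zero[OF b c a r(2)]
    pre_lie_sum_zero[OF c a b r(3)]
  \<comment> \<open>Each group on the right keeps the two \<open>R\<close> terms of one double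
    commutator and takes one \<open>L\<close> term from each of the other two. Every group is then
    an instance of the rearranged pre-Lie identity.\<close>
  have "commutator (p * q) t (commutator p q a b) c
      \<oplus>\<^bsub>A r\<^esub> commutator (q * t) p (commutator q t b c) a
      \<oplus>\<^bsub>A r\<^esub> commutator (t * p) q (commutator t p c a) b
    = ((R p q t a b c \<ominus>\<^bsub>A r\<^esub> R q p t b a c) \<oplus>\<^bsub>A r\<^esub> (L q p t b a c \<ominus>\<^bsub>A r\<^esub> L p q t a b c))
      \<oplus>\<^bsub>A r\<^esub> ((R q t p b c a \<ominus>\<^bsub>A r\<^esub> R t q p c b a) \<oplus>\<^bsub>A r\<^esub> (L t q p c b a \<ominus>\<^bsub>A r\<^esub> L q t p b c a))
      \<oplus>\<^bsub>A r\<^esub> ((R t p q c a b \<ominus>\<^bsub>A r\<^esub> R p t q a c b) \<oplus>\<^bsub>A r\<^esub> (L p t q a c b \<ominus>\<^bsub>A r\<^esub> L t p q c a b))"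
    unfolding comm R_def[symmetric] L_def[symmetric] using closed by (simp add: W.minus_eq W.minus_add W.a_ac)
  also have "\<dots> = \<zero>\<^bsub>A r\<^esub>"
    using zero unfolding R_def[symmetric] L_def[symmetric] by simp
  finally show ?thesis unfolding r .
qed

end

theorem proposition4p10:
  fixes K :: "('k, 'm) ring_scheme"
    and A :: "'p::ab_semigroup_mult \<Rightarrow> ('k, 'a, 'n) module_scheme"
    and star :: "'p \<Rightarrow> 'p \<Rightarrow> 'a \<Rightarrow> 'a \<Rightarrow> 'a"
  assumes "pre_lie_T_algebra K A star"
  shows "lie_T_algebra K A (\<lambda>p q a b. star p q a b \<ominus>\<^bsub>A (p * q)\<^esub> star q p b a)"
proof -
  interpret pre_lie_T_algebra K A star by fact
  show ?thesis
    by unfold_locales (rule commutator_bilinear commutator_antisymmetric commutator_jacobi; assumption)+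
qed

end
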